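(* Let $\mathcal{H}$ be a real Hilbert space, let $G:\mathcal{H}\to\mathcal{H}$, let $C$ be a nonempty closed convex subset of $\mathcal{H}$, and let $\gamma\in[0,1[$. Suppose that $\mathrm{P}_C G=\mathrm{P}_C$ and that $$(\forall x\in\mathcal{H})\quad \|Gx-\mathrm{P}_C x\|\le\gamma\|x-\mathrm{P}_C x\|.$$ Then the following hold: (i) $G\mathrm{P}_C=\mathrm{P}_C$. (ii) $\operatorname{Fix}G=C$. (iii) $G$ is a $\gamma$-BAM.
   Context: For a nonempty closed convex set $C\subseteq\mathcal{H}$, $\mathrm{P}_C$ denotes the metric projection onto $C$. $\operatorname{Fix}G=\{x\in\mathcal{H}: Gx=x\}$. Products of operators denote composition. Definition (BAM). Let $G:\mathcal{H}\to\mathcal{H}$ and $\gamma\in[0,1[$. $G$ is a best approximation mapping with constant $\gamma$ ($\gamma$-BAM) if (1) $\operatorname{Fix}G$ is a nonempty closed convex subset of $\mathcal{H}$; (2) $\mathrm{P}_{\operatorname{Fix}G}G=\mathrm{P}_{\operatorname{Fix}G}$; (3) $\|Gx-\mathrm{P}_{\operatorname{Fix}G}x\|\le\gamma\|x-\mathrm{P}_{\operatorname{Fix}G}x\|$ for all $x\in\mathcal{H}$. *)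

theory Defs
  imports "HOL-Analysis.Analysis"
begin

text \<open>
  Real Hilbert spaces are types of sort \<open>{real_inner, complete_space}\<close>. The library's
  \<open>closest_point\<close> is restricted to class \<open>heine_borel\<close>, which excludes infinite-dimensional
  spaces, so the metric projection is defined afresh. The description is proper whenever \<open>C\<close> is
  nonempty, closed and convex; for other sets \<open>C\<close> the value is unspecified.
\<close>

definition metric_proj :: "'a::{real_inner, complete_space} set \<Rightarrow> 'a \<Rightarrow> 'a"
  where "metric_proj C x = (THE p. p \<in> C \<and> (\<forall>y\<in>C. norm (x - p) \<le> norm (x - y)))"

definition Fix :: "('a \<Rightarrow> 'a) \<Rightarrow> 'a set"
  where "Fix G = {x. G x = x}"

definition BAM :: "real \<Rightarrow> ('a::{real_inner, complete_space} \<Rightarrow> 'a) \<Rightarrow> bool"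
  where "BAM \<gamma> G \<longleftrightarrow>
    \<gamma> \<in> {0..<1} \<and>
    Fix G \<noteq> {} \<and> closed (Fix G) \<and> convex (Fix G) \<and>
    metric_proj (Fix G) \<circ> G = metric_proj (Fix G) \<and>
    (\<forall>x. norm (G x - metric_proj (Fix G) x) \<le> \<gamma> * norm (x - metric_proj (Fix G) x))"

end

theory Submission
  imports Defs
begin

text \<open>
  A point of \<open>C\<close> is its own projection, so the contraction estimate forces \<open>G\<close> to fix it.
  Conversely, if \<open>G x = x\<close>, then the estimate with constant \<open>\<gamma> < 1\<close> forces \<open>x\<close> to
  equal its projection, which lies in \<open>C\<close>. Existence and uniqueness of the projection come from
  the parallelogram law: points of \<open>C\<close> nearly minimising the distance to \<open>x\<close> are close to
  each other because their midpoint is in \<open>C\<close> as well.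
\<close>

text \<open>Quantitative core of both existence and uniqueness: \<open>d\<close> is any lower bound
  for the squared distances, and the separate slacks \<open>a\<close>, \<open>b\<close> allow two
  different terms of a minimising sequence as well as two exact minimisers.\<close>

lemma convex_near_minimizers_close:
  fixes x y z :: "'a::real_inner"
  assumes "convex C" "y \<in> C" "z \<in> C"
    and lower: "\<And>w. w \<in> C \<Longrightarrow> d \<le> (norm (x - w))\<^sup>2"
    and "(norm (x - y))\<^sup>2 \<le> d + a" "(norm (x - z))\<^sup>2 \<le> d + b"
  shows "(norm (y - z))\<^sup>2 \<le> 2 * (a + b)"
proof -
  define m where "m = (1/2) *\<^sub>R y + (1/2) *\<^sub>R z"
  have "m \<in> C"
    unfolding m_def using assms(1-3) by (intro convexD) auto
  then have "d \<le> (norm (x - m))\<^sup>2"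
    by (rule lower)
  \<comment> \<open>Parallelogram law for \<open>x - y\<close> and \<open>x - z\<close>, whose sum
    is \<open>2 *\<^sub>R (x - m)\<close>; hence the factor 4.\<close>
  moreover have "(norm (y - z))\<^sup>2
      = 2 * (norm (x - y))\<^sup>2 + 2 * (norm (x - z))\<^sup>2 - 4 * (norm (x - m))\<^sup>2"
    unfolding m_def power2_norm_eq_inner
    by (simp add: inner_diff_left inner_diff_right inner_add_left inner_add_right
        inner_commute field_simps)
  ultimately show ?thesis
    using assms(5,6) by simp
qed

lemma ex_nearest_point:
  fixes x :: "'a::{real_inner, complete_space}"
  assumes "C \<noteq> {}" "closed C" "convex C"
  shows "\<exists>p\<in>C. \<forall>y\<in>C. norm (x - p) \<le> norm (x - y)"
proof -
  define d where "d = (INF y\<in>C. (norm (x - y))\<^sup>2)"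
  have bdd: "bdd_below ((\<lambda>y. (norm (x - y))\<^sup>2) ` C)"
    by (rule bdd_belowI2[of _ 0]) simp
  have lower: "d \<le> (norm (x - w))\<^sup>2" if "w \<in> C" for w
    unfolding d_def using bdd that by (rule cINF_lower)
  \<comment> \<open>A minimising sequence: each bound lies strictly above the infimum
    \<open>d\<close>.\<close>
  have "\<exists>y\<in>C. (norm (x - y))\<^sup>2 < d + 1 / real (Suc n)" for n
    using cINF_less_iff[OF assms(1) bdd, of "d + 1 / real (Suc n)"] by (simp add: d_def)
  then obtain f where f: "\<And>n. f n \<in> C" "\<And>n. (norm (x - f n))\<^sup>2 < d + 1 / real (Suc n)"
    by metis
  have "Cauchy f"
  proof (rule CauchyI)
    fix e :: real
    assume "0 < e"
    \<comment> \<open>The slacks of two terms from index \<open>N\<close> on give at most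
      \<open>4 / real (Suc N)\<close>, which has to stay below \<open>e\<^sup>2\<close>.\<close>
    obtain N where N: "1 / real (Suc N) < e\<^sup>2 / 4"
      using nat_approx_posE[of "e\<^sup>2 / 4"] \<open>0 < e\<close> by auto
    have "norm (f m - f n) < e" if "N \<le> m" "N \<le> n" for m n
    proof -
      have "(norm (f m - f n))\<^sup>2 \<le> 2 * (1 / real (Suc m) + 1 / real (Suc n))"
        using assms(3) f less_imp_le[OF f(2)] lower by (intro convex_near_minimizers_close) auto
      also have "\<dots> \<le> 2 * (1 / real (Suc N) + 1 / real (Suc N))"
        using that by (intro mult_left_mono add_mono divide_left_mono) auto
      also have "\<dots> < e\<^sup>2"
        using N by simp
      finally show ?thesis
        using \<open>0 < e\<close> by (simp add: power_less_imp_less_base)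
    qed
    then show "\<exists>N. \<forall>m\<ge>N. \<forall>n\<ge>N. norm (f m - f n) < e"
      by blast
  qed
  then obtain p where p: "f \<longlonglongrightarrow> p"
    using Cauchy_convergent convergent_def by blast
  have "p \<in> C"
    using closed_sequentially[OF assms(2)] f(1) p by blast
  \<comment> \<open>By continuity of the norm the limit attains the infimum.\<close>
  moreover have "(norm (x - p))\<^sup>2 \<le> d"
  proof (rule LIMSEQ_le)
    show "(\<lambda>n. (norm (x - f n))\<^sup>2) \<longlonglongrightarrow> (norm (x - p))\<^sup>2"
      using p by (intro tendsto_intros)
    show "(\<lambda>n. d + 1 / real (Suc n)) \<longlonglongrightarrow> d"
      using LIMSEQ_inverse_real_of_nat_add[of d] by (simp add: inverse_eq_divide)
    show "\<exists>N. \<forall>n\<ge>N. (norm (x - f n))\<^sup>2 \<le> d + 1 / real (Suc n)"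
      using f(2) less_imp_le by blast
  qed
  ultimately show ?thesis
    using lower by (meson norm_ge_zero order_trans power2_le_imp_le)
qed

lemma nearest_point_unique:
  fixes x p q :: "'a::real_inner"
  assumes "convex C" "p \<in> C" "q \<in> C"
    and "\<And>y. y \<in> C \<Longrightarrow> norm (x - p) \<le> norm (x - y)"
    and "\<And>y. y \<in> C \<Longrightarrow> norm (x - q) \<le> norm (x - y)"
  shows "p = q"
proof -
  \<comment> \<open>Both slacks vanish, since \<open>p\<close> and \<open>q\<close> are each at
    least as near to \<open>x\<close> as the other.\<close>
  have "(norm (p - q))\<^sup>2 \<le> 2 * (0 + 0)"
    using assms
    by (intro convex_near_minimizers_close[where d = "(norm (x - p))\<^sup>2" and x = x]) auto
  then show ?thesis
    by simp
qed

lemma metric_proj_eqI: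
  assumes "convex C" "p \<in> C" "\<And>y. y \<in> C \<Longrightarrow> norm (x - p) \<le> norm (x - y)"
  shows "metric_proj C x = p"
  unfolding metric_proj_def
proof (rule the_equality)
  show "p \<in> C \<and> (\<forall>y\<in>C. norm (x - p) \<le> norm (x - y))"
    using assms by simp
  show "q = p" if "q \<in> C \<and> (\<forall>y\<in>C. norm (x - q) \<le> norm (x - y))" for q
    using that assms by (intro nearest_point_unique[of C q p x]) auto
qed

lemma metric_proj_in:
  assumes "C \<noteq> {}" "closed C" "convex C"
  shows "metric_proj C x \<in> C"
proof -
  obtain p where p: "p \<in> C" "\<forall>y\<in>C. norm (x - p) \<le> norm (x - y)"
    using ex_nearest_point[OF assms] by blast
  then have "metric_proj C x = p"
    using assms(3) by (intro metric_proj_eqI) auto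
  with p(1) show ?thesis
    by simp
qed

lemma metric_proj_self:
  assumes "convex C" "x \<in> C"
  shows "metric_proj C x = x"
  using assms by (intro metric_proj_eqI) auto

theorem lemma3p2:
  fixes G :: "'a::{real_inner, complete_space} \<Rightarrow> 'a"
    and C :: "'a set"
    and \<gamma> :: real
  assumes "C \<noteq> {}" and "closed C" and "convex C"
    and "\<gamma> \<in> {0..<1}"
    and "metric_proj C \<circ> G = metric_proj C"
    and "\<forall>x. norm (G x - metric_proj C x) \<le> \<gamma> * norm (x - metric_proj C x)"
  shows "G \<circ> metric_proj C = metric_proj C \<and> Fix G = C \<and> BAM \<gamma> G"
proof -
  note estimate = assms(6)[rule_format]
  have fixes_C: "G c = c" if "c \<in> C" for c
    using estimate[of c] metric_proj_self[OF assms(3) that] by simp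
  have "x \<in> C" if "G x = x" for x
  proof -
    \<comment> \<open>For a fixed point the estimate bounds a norm by \<open>\<gamma>\<close> times
      itself; the factor \<open>1 - \<gamma>\<close> is positive.\<close>
    have "(1 - \<gamma>) * norm (x - metric_proj C x) \<le> 0"
      using estimate[of x] that by (simp add: algebra_simps)
    with assms(4) have "x = metric_proj C x"
      by (simp add: mult_le_0_iff)
    then show ?thesis
      using metric_proj_in[OF assms(1-3), of x] by simp
  qed
  with fixes_C have "Fix G = C"
    by (auto simp: Fix_def)
  moreover have "G \<circ> metric_proj C = metric_proj C"
    using fixes_C metric_proj_in[OF assms(1-3)] by auto
  \<comment> \<open>After rewriting \<open>Fix G\<close> to \<open>C\<close>, the clauses of
    \<open>BAM\<close> are exactly the hypotheses.\<close>
  ultimately show ?thesis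
    using assms by (simp add: BAM_def)
qed

end
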